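(* Let $\gamma\in[0,1)$. For any two stationary randomized policies $\pi_1$ and $\pi_2$ the difference of their discounted returns satisfies $$\eta^{(\gamma)}_{\pi_2}(\mu)-\eta^{(\gamma)}_{\pi_1}(\mu)\le \mathbb E_{x\sim d^{(\gamma)}_{\pi_1},\,a\sim\pi_2(\cdot|x)}\left[A^{(\gamma)}_{\pi_1}(x,a)\right]+2\gamma\,\epsilon^{(\gamma)}_{\pi_2}\,\tau_1\!\left[D^{(\gamma)}_{\pi_2}\right]\,\mathbb E_{x\sim d^{(\gamma)}_{\pi_1}}\left[\mathrm{TV}\big(\pi_2(\cdot|x)\,\|\,\pi_1(\cdot|x)\big)\right].$$
   Context: Setting: a Markov decision process with finite state space $\mathcal X$, finite action space $\mathcal A$, transition probabilities $P(y|x,a)$, cost function $g:\mathcal X\times\mathcal A\to\mathbb R$, initial state distribution $\mu$. For a stationary randomized policy $\pi$, $P_\pi(x,y)=\sum_a\pi(a|x)P(y|x,a)$; the MDP is unichain: for every stationary policy, $P_\pi$ has a single recurrent class. Discounted quantities: $V^{(\gamma)}_\pi(x)=\mathbb E_\pi[\sum_{t\ge0}\gamma^tg(x^{(t)},a^{(t)})\mid x^{(0)}=x]$; $Q^{(\gamma)}_\pi(x,a)=g(x,a)+\gamma\,\mathbb E_{y\sim P(\cdot|x,a)}[V_\pi^{(\gamma)}(y)]$; $A_\pi^{(\gamma)}=Q_\pi^{(\gamma)}-V_\pi^{(\gamma)}$; $d_\pi^{(\gamma)}(x)=(1-\gamma)\sum_{t\ge0}\gamma^t\,\mathbb P[x^{(t)}=x\mid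 x^{(0)}\sim\mu]$ under $\pi$; $\eta_\pi^{(\gamma)}(\mu)=(1-\gamma)\mathbb E_{x\sim\mu}[V_\pi^{(\gamma)}(x)]=\mathbb E_{x\sim d_\pi^{(\gamma)},a\sim\pi(\cdot|x)}[g(x,a)]$. $P_\pi^{(\gamma)}=\gamma P_\pi+(1-\gamma)e\mu^T$, where $e$ is the all-ones vector; $D_\pi^{(\gamma)}$ is the group inverse of $I-P_\pi^{(\gamma)}$ (the group inverse $D$ of a matrix $A$ is the unique matrix with $ADA=A$, $DAD=D$, $DA=AD$). The one-norm ergodicity coefficient of a matrix $A$ is $\tau_1[A]=\max\{\|A^Tx\|_1:\|x\|_1=1,\ x^Te=0\}$. $\mathrm{TV}(\pi_2(\cdot|x)\|\pi_1(\cdot|x))=\frac12\sum_{a}|\pi_2(a|x)-\pi_1(a|x)|$ and $\epsilon^{(\gamma)}_{\pi_2}=\max_{x\in\mathcal X}\big|\mathbb E_{a\sim\pi_2(\cdot|x)}[A^{(\gamma)}_{\pi_1}(x,a)]\big|$. *)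

theory Defs
  imports "HOL-Probability.Probability"
begin

text \<open>
  States and actions are the finite types \<open>'x\<close> and \<open>'a\<close>. A transition kernel is a function
  \<open>P :: 'x \<Rightarrow> 'a \<Rightarrow> 'x pmf\<close> and a stationary randomized policy a function \<open>\<pi> :: 'x \<Rightarrow> 'a pmf\<close>.
\<close>

text \<open>
  A trajectory is a sequence \<open>\<omega> :: nat \<Rightarrow> 'x \<times> 'a\<close> with \<open>\<omega> t = (x\<^sub>t, a\<^sub>t)\<close>; its law under \<open>\<pi>\<close> with
  \<open>x\<^sub>0 \<sim> \<nu>\<close> is the Ionescu-Tulcea limit of the kernels below. Conditioning on \<open>x\<^sub>0 = x\<close> is
  rendered by starting from \<open>\<nu> = return_pmf x\<close>, so that it makes sense for every \<open>x\<close>.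
\<close>

definition with_action :: "('x \<Rightarrow> 'a pmf) \<Rightarrow> 'x pmf \<Rightarrow> ('x \<times> 'a) pmf" where
  "with_action \<pi> \<nu> = bind_pmf \<nu> (\<lambda>x. map_pmf (Pair x) (\<pi> x))"

primrec step_kernel ::
    "('x \<Rightarrow> 'a \<Rightarrow> 'x pmf) \<Rightarrow> 'x pmf \<Rightarrow> ('x \<Rightarrow> 'a pmf) \<Rightarrow> nat \<Rightarrow> (nat \<Rightarrow> 'x \<times> 'a) \<Rightarrow> ('x \<times> 'a) measure" where
  "step_kernel P \<nu> \<pi> 0 \<omega> = measure_pmf (with_action \<pi> \<nu>)"
| "step_kernel P \<nu> \<pi> (Suc t) \<omega> = measure_pmf (with_action \<pi> (P (fst (\<omega> t)) (snd (\<omega> t))))"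

lemma Ionescu_Tulcea_step_kernel:
  fixes P :: "'x::finite \<Rightarrow> 'a::finite \<Rightarrow> 'x pmf"
  shows "Ionescu_Tulcea (step_kernel P \<nu> \<pi>) (\<lambda>_. count_space UNIV)"
proof (rule Ionescu_Tulcea.intro)
  fix t :: nat
  show "step_kernel P \<nu> \<pi> t \<in>
      measurable (PiM {0..<t} (\<lambda>_. count_space UNIV)) (subprob_algebra (count_space UNIV))"
  proof (cases t)
    case 0
    have "step_kernel P \<nu> \<pi> t = (\<lambda>_. measure_pmf (with_action \<pi> \<nu>))"
      by (simp add: 0 fun_eq_iff)
    then show ?thesis
      by (simp add: measurable_const measure_pmf_in_subprob_algebra)
  next
    case (Suc s)
    have eq: "step_kernel P \<nu> \<pi> t =
        (\<lambda>z. measure_pmf (with_action \<pi> (P (fst z) (snd z)))) \<circ> (\<lambda>\<omega>. \<omega> s)"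
      by (simp add: Suc fun_eq_iff)
    show ?thesis
      unfolding eq
    proof (rule measurable_comp)
      show "(\<lambda>\<omega>. \<omega> s) \<in> measurable (PiM {0..<t} (\<lambda>_. count_space UNIV)) (count_space UNIV)"
        using Suc by (intro measurable_component_singleton) auto
      show "(\<lambda>z. measure_pmf (with_action \<pi> (P (fst z) (snd z)))) \<in>
          measurable (count_space UNIV) (subprob_algebra (count_space UNIV))"
        by (auto simp: measurable_count_space_eq1 measure_pmf_in_subprob_algebra)
    qed
  qed
next
  fix t :: nat and \<omega> :: "nat \<Rightarrow> 'x \<times> 'a"
  show "prob_space (step_kernel P \<nu> \<pi> t \<omega>)"
    by (cases t) (simp_all add: prob_space_measure_pmf)
qed

definition trajectory ::
    "('x::finite \<Rightarrow> 'a::finite \<Rightarrow> 'x pmf) \<Rightarrow> 'x pmf \<Rightarrow> ('x \<Rightarrow> 'a pmf) \<Rightarrow> (nat \<Rightarrow> 'x \<times> 'a) measure" where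
  "trajectory P \<nu> \<pi> =
     projective_family.lim UNIV
       (Ionescu_Tulcea.CI (step_kernel P \<nu> \<pi>) (\<lambda>_. count_space UNIV)) (\<lambda>_. count_space UNIV)"

definition trans_mat ::
    "('x::finite \<Rightarrow> 'a::finite \<Rightarrow> 'x pmf) \<Rightarrow> ('x \<Rightarrow> 'a pmf) \<Rightarrow> real^'x^'x" where
  "trans_mat P \<pi> = (\<chi> x y. \<Sum>a\<in>UNIV. pmf (\<pi> x) a * pmf (P x a) y)"

definition accessible :: "real^'x^'x \<Rightarrow> 'x::finite \<Rightarrow> 'x \<Rightarrow> bool" where
  "accessible A x y \<longleftrightarrow> (x, y) \<in> {(u, v). A $ u $ v > 0}\<^sup>*"

text \<open>
  In a finite chain a state is recurrent iff it is accessible from every state accessible from it;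
  the states accessible from a recurrent state then form its recurrent class.
\<close>

definition recurrent :: "real^'x^'x \<Rightarrow> 'x::finite \<Rightarrow> bool" where
  "recurrent A x \<longleftrightarrow> (\<forall>y. accessible A x y \<longrightarrow> accessible A y x)"

definition recurrent_class :: "real^'x^'x \<Rightarrow> 'x::finite set \<Rightarrow> bool" where
  "recurrent_class A C \<longleftrightarrow> (\<exists>x. recurrent A x \<and> C = {y. accessible A x y})"

definition unichain :: "('x::finite \<Rightarrow> 'a::finite \<Rightarrow> 'x pmf) \<Rightarrow> bool" where
  "unichain P \<longleftrightarrow> (\<forall>\<pi>. \<exists>!C. recurrent_class (trans_mat P \<pi>) C)"

definition disc_V ::
    "('x::finite \<Rightarrow> 'a::finite \<Rightarrow> 'x pmf) \<Rightarrow> ('x \<Rightarrow> 'a \<Rightarrow> real) \<Rightarrow> real \<Rightarrow> ('x \<Rightarrow> 'a pmf) \<Rightarrow> 'x \<Rightarrow> real" where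
  "disc_V P g \<gamma> \<pi> x =
     (\<integral>\<omega>. (\<Sum>t. \<gamma> ^ t * g (fst (\<omega> t)) (snd (\<omega> t))) \<partial>trajectory P (return_pmf x) \<pi>)"

definition disc_Q ::
    "('x::finite \<Rightarrow> 'a::finite \<Rightarrow> 'x pmf) \<Rightarrow> ('x \<Rightarrow> 'a \<Rightarrow> real) \<Rightarrow> real \<Rightarrow> ('x \<Rightarrow> 'a pmf) \<Rightarrow> 'x \<Rightarrow> 'a \<Rightarrow> real" where
  "disc_Q P g \<gamma> \<pi> x a = g x a + \<gamma> * measure_pmf.expectation (P x a) (disc_V P g \<gamma> \<pi>)"

definition disc_A ::
    "('x::finite \<Rightarrow> 'a::finite \<Rightarrow> 'x pmf) \<Rightarrow> ('x \<Rightarrow> 'a \<Rightarrow> real) \<Rightarrow> real \<Rightarrow> ('x \<Rightarrow> 'a pmf) \<Rightarrow> 'x \<Rightarrow> 'a \<Rightarrow> real" where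
  "disc_A P g \<gamma> \<pi> x a = disc_Q P g \<gamma> \<pi> x a - disc_V P g \<gamma> \<pi> x"

definition disc_d ::
    "('x::finite \<Rightarrow> 'a::finite \<Rightarrow> 'x pmf) \<Rightarrow> 'x pmf \<Rightarrow> real \<Rightarrow> ('x \<Rightarrow> 'a pmf) \<Rightarrow> 'x \<Rightarrow> real" where
  "disc_d P \<mu> \<gamma> \<pi> x =
     (1 - \<gamma>) * (\<Sum>t. \<gamma> ^ t * \<P>(\<omega> in trajectory P \<mu> \<pi>. fst (\<omega> t) = x))"

definition disc_eta ::
    "('x::finite \<Rightarrow> 'a::finite \<Rightarrow> 'x pmf) \<Rightarrow> ('x \<Rightarrow> 'a \<Rightarrow> real) \<Rightarrow> 'x pmf \<Rightarrow> real \<Rightarrow> ('x \<Rightarrow> 'a pmf) \<Rightarrow> real" where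
  "disc_eta P g \<mu> \<gamma> \<pi> = (1 - \<gamma>) * measure_pmf.expectation \<mu> (disc_V P g \<gamma> \<pi>)"

definition policy_TV :: "('x \<Rightarrow> 'a::finite pmf) \<Rightarrow> ('x \<Rightarrow> 'a pmf) \<Rightarrow> 'x \<Rightarrow> real" where
  "policy_TV \<pi>2 \<pi>1 x = (1/2) * (\<Sum>a\<in>UNIV. \<bar>pmf (\<pi>2 x) a - pmf (\<pi>1 x) a\<bar>)"

definition disc_eps ::
    "('x::finite \<Rightarrow> 'a::finite \<Rightarrow> 'x pmf) \<Rightarrow> ('x \<Rightarrow> 'a \<Rightarrow> real) \<Rightarrow> real \<Rightarrow> ('x \<Rightarrow> 'a pmf) \<Rightarrow> ('x \<Rightarrow> 'a pmf) \<Rightarrow> real" where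
  "disc_eps P g \<gamma> \<pi>1 \<pi>2 =
     Max (range (\<lambda>x. \<bar>measure_pmf.expectation (\<pi>2 x) (disc_A P g \<gamma> \<pi>1 x)\<bar>))"

definition is_group_inverse :: "real^'n^'n \<Rightarrow> real^'n^'n \<Rightarrow> bool" where
  "is_group_inverse A D \<longleftrightarrow> A ** D ** A = A \<and> D ** A ** D = D \<and> D ** A = A ** D"

lemma is_group_inverse_unique:
  assumes "is_group_inverse A D" "is_group_inverse A E"
  shows "D = E"
proof -
  have D: "A ** D ** A = A" "D ** A ** D = D" "D ** A = A ** D"
    and E: "A ** E ** A = A" "E ** A ** E = E" "E ** A = A ** E"
    using assms by (auto simp: is_group_inverse_def)
  have "A ** D = E ** A ** A ** D"
    using E by (metis matrix_mul_assoc)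
  also have "\<dots> = E ** A"
    using D by (metis matrix_mul_assoc)
  finally have AD: "A ** D = E ** A" .
  have "D = D ** (A ** D)"
    using D(2) by (simp add: matrix_mul_assoc)
  also have "\<dots> = (A ** D) ** E"
    using AD D(3) E(3) by (metis matrix_mul_assoc)
  also have "\<dots> = E"
    using AD E(2) by simp
  finally show ?thesis .
qed

definition group_inverse :: "real^'n^'n \<Rightarrow> real^'n^'n" where
  "group_inverse A = (THE D. is_group_inverse A D)"

definition norm1 :: "real^'n \<Rightarrow> real" where
  "norm1 x = (\<Sum>i\<in>UNIV. \<bar>x $ i\<bar>)"

definition ergodicity_set :: "real^'n^'n \<Rightarrow> real set" where
  "ergodicity_set A = {norm1 (transpose A *v x) | x. norm1 x = 1 \<and> x \<bullet> vec 1 = 0}"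

text \<open>
  For \<open>CARD('n) = 1\<close> no vector is admissible; the maximum over the empty set is then taken to
  be \<open>0\<close>. Otherwise the supremum is attained, see \<open>tau1_in_ergodicity_set\<close>.
\<close>

definition tau1 :: "real^'n^'n \<Rightarrow> real" where
  "tau1 A = (if ergodicity_set A = {} then 0 else Sup (ergodicity_set A))"

lemma compact_ergodicity_set: "compact (ergodicity_set A)"
proof -
  let ?K = "{x :: real^'n. norm1 x = 1 \<and> x \<bullet> vec 1 = 0}"
  have cont: "continuous_on S (norm1 :: real^'n \<Rightarrow> real)" for S
    unfolding norm1_def by (intro continuous_intros)
  have "closed {x :: real^'n. norm1 x = 1}" "closed {x :: real^'n. x \<bullet> vec 1 = 0}"
    by (intro closed_Collect_eq cont continuous_intros)+
  then have "closed ?K"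
    by (auto simp: Collect_conj_eq intro: closed_Int)
  moreover have "bounded ?K"
    by (rule boundedI[where B = 1]) (metis (mono_tags, lifting) mem_Collect_eq norm1_def norm_le_l1_cart)
  ultimately have "compact ?K"
    by (simp add: compact_eq_bounded_closed)
  moreover have "continuous_on ?K (\<lambda>x. norm1 (transpose A *v x))"
    by (rule continuous_on_compose2[OF cont[of UNIV]])
      (auto simp del: transpose_matrix_vector intro!: linear_continuous_on matrix_vector_mul_bounded_linear)
  ultimately have "compact ((\<lambda>x. norm1 (transpose A *v x)) ` ?K)"
    by (rule compact_continuous_image[rotated])
  also have "(\<lambda>x. norm1 (transpose A *v x)) ` ?K = ergodicity_set A"
    by (auto simp: ergodicity_set_def)
  finally show ?thesis .
qed

lemma tau1_in_ergodicity_set: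
  assumes "ergodicity_set A \<noteq> {}"
  shows "tau1 A \<in> ergodicity_set A" and "\<And>r. r \<in> ergodicity_set A \<Longrightarrow> r \<le> tau1 A"
proof -
  obtain s where s: "s \<in> ergodicity_set A" "\<forall>r\<in>ergodicity_set A. r \<le> s"
    using compact_attains_sup[OF compact_ergodicity_set assms] by blast
  then have "tau1 A = s"
    using assms by (auto simp: tau1_def intro: cSup_eq_maximum)
  with s show "tau1 A \<in> ergodicity_set A" and "\<And>r. r \<in> ergodicity_set A \<Longrightarrow> r \<le> tau1 A"
    by auto
qed

text \<open>The \<open>(x, y)\<close> entry of \<open>e \<mu>\<^sup>T\<close> is \<open>\<mu>(y)\<close>.\<close>

definition disc_mat ::
    "('x::finite \<Rightarrow> 'a::finite \<Rightarrow> 'x pmf) \<Rightarrow> 'x pmf \<Rightarrow> real \<Rightarrow> ('x \<Rightarrow> 'a pmf) \<Rightarrow> real^'x^'x" where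
  "disc_mat P \<mu> \<gamma> \<pi> = \<gamma> *\<^sub>R trans_mat P \<pi> + (1 - \<gamma>) *\<^sub>R (\<chi> x y. pmf \<mu> y)"

definition disc_D ::
    "('x::finite \<Rightarrow> 'a::finite \<Rightarrow> 'x pmf) \<Rightarrow> 'x pmf \<Rightarrow> real \<Rightarrow> ('x \<Rightarrow> 'a pmf) \<Rightarrow> real^'x^'x" where
  "disc_D P \<mu> \<gamma> \<pi> = group_inverse (mat 1 - disc_mat P \<mu> \<gamma> \<pi>)"

end

theory Submission
  imports Defs
begin

text \<open>
  Write \<open>M\<^sub>i = I - \<gamma> P\<^sub>i\<close>. The trajectory measure enters only through \<open>M\<^sub>i V\<^sub>i = r\<^sub>i\<close> (\<open>r\<^sub>i\<close> the expected
  one-step cost) and \<open>d\<^sub>i M\<^sub>i = (1 - \<gamma>) \<mu>\<close>. They give \<open>\<eta>\<^sub>2 - \<eta>\<^sub>1 = d\<^sub>2 b\<close> with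
  \<open>b(x) = E\<^sub>a\<^sub>\<sim>\<^sub>\<pi>\<^sub>2 A\<^sub>1(x,a)\<close>, so the claim reduces to a bound on the one-norm of \<open>d\<^sub>2 - d\<^sub>1\<close>.

  With \<open>A = M\<^sub>2 - (1 - \<gamma>) e \<mu>\<^sup>T\<close> one has \<open>(d\<^sub>2 - d\<^sub>1) A = \<gamma> d\<^sub>1 (P\<^sub>2 - P\<^sub>1)\<close>. As \<open>A D\<^sub>2 = I - e d\<^sub>2\<close> fixes
  row vectors of sum zero, \<open>d\<^sub>2 - d\<^sub>1 = \<gamma> d\<^sub>1 (P\<^sub>2 - P\<^sub>1) D\<^sub>2\<close>, and \<open>\<tau>\<^sub>1\<close> bounds the effect of \<open>D\<^sub>2\<close> on the
  sum-zero vector \<open>d\<^sub>1 (P\<^sub>2 - P\<^sub>1)\<close>.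
\<close>

section \<open>Coordinate marginals of an Ionescu-Tulcea limit\<close>

context Ionescu_Tulcea
begin

lemma measurable_coordinate:
  "(\<lambda>\<omega>. \<omega> t) \<in> measurable (PiM {0..<Suc t} M) (M t)"
  by (rule measurable_component_singleton) simp

text \<open>Coordinate \<open>t\<close> is unchanged by restriction to \<open>{0..<Suc t}\<close>,
  and the projection of the limit to that finite index set comes from the finite-horizon
  measure.\<close>

lemma nn_integral_lim_coordinate:
  assumes f: "f \<in> borel_measurable (M t)"
  shows "(\<integral>\<^sup>+\<omega>. f (\<omega> t) \<partial>PF.lim) = (\<integral>\<^sup>+\<omega>. f (\<omega> t) \<partial>C 0 (Suc t) (\<lambda>_. undefined))"
proof -
  let ?J = "{0..<Suc t}" and ?u = "\<lambda>_. undefined"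
  have u: "?u \<in> space (PiM {0..<0} M)"
    by (simp add: space_PiM)
  have fc: "(\<lambda>\<omega>. f (\<omega> t)) \<in> borel_measurable (PiM ?J M)"
    by (rule measurable_compose[OF measurable_coordinate f])
  \<comment> \<open>\<open>CI ?J\<close> is an image of \<open>C 0 (up_to ?J)\<close>, so this
    identifies the horizon of the finite-time measure.\<close>
  have up: "up_to ?J = Suc t"
  proof (rule antisym)
    show "up_to ?J \<le> Suc t"
      by (simp add: up_to_iff_Ico)
    show "Suc t \<le> up_to ?J"
      using up_to_less[of ?J t] by simp
  qed
  have "(\<integral>\<^sup>+\<omega>. f (\<omega> t) \<partial>PF.lim)
      = (\<integral>\<^sup>+\<omega>. f (\<omega> t) \<partial>distr PF.lim (PiM ?J M) (\<lambda>\<omega>. restrict \<omega> ?J))"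
    using fc by (subst nn_integral_distr)
      (auto simp: measurable_cong_sets[OF PF.sets_lim refl] intro!: measurable_restrict_subset)
  also have "\<dots> = (\<integral>\<^sup>+\<omega>. f (\<omega> t) \<partial>CI ?J)"
    by (simp add: distr_lim)
  also have "\<dots> = (\<integral>\<^sup>+\<omega>. f (\<omega> t) \<partial>C 0 (Suc t) ?u)"
    using fc unfolding CI_def up
    by (subst nn_integral_distr)
      (auto simp: measurable_cong_sets[OF sets_C[OF u] refl] simp del: C.simps intro!: measurable_restrict_subset)
  finally show ?thesis .
qed

text \<open>\<open>C 0 (Suc t)\<close> binds \<open>C 0 t\<close> with \<open>eP t\<close>, which
  appends one coordinate drawn from \<open>P t\<close>; only this new coordinate is
  integrated.\<close>

lemma nn_integral_C_coordinate:
  assumes f: "f \<in> borel_measurable (M t)"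
  shows "(\<integral>\<^sup>+\<omega>. f (\<omega> t) \<partial>C 0 (Suc t) (\<lambda>_. undefined))
    = (\<integral>\<^sup>+\<omega>. \<integral>\<^sup>+x. f x \<partial>P t \<omega> \<partial>C 0 t (\<lambda>_. undefined))"
proof -
  let ?u = "\<lambda>_. undefined"
  have u: "?u \<in> space (PiM {0..<0} M)"
    by (simp add: space_PiM)
  have fc: "(\<lambda>\<omega>. f (\<omega> t)) \<in> borel_measurable (PiM {0..<Suc t} M)"
    by (rule measurable_compose[OF measurable_coordinate f])
  have eP: "eP t \<in> measurable (C 0 t ?u) (subprob_algebra (PiM {0..<Suc t} M))"
    using measurable_eP[of t] by (simp add: measurable_cong_sets[OF sets_C[OF u] refl])
  have sp: "space (C 0 t ?u) = space (PiM {0..<t} M)"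
    using space_C[OF u, of t] by simp
  have "(\<integral>\<^sup>+\<omega>. f (\<omega> t) \<partial>C 0 (Suc t) ?u) = (\<integral>\<^sup>+\<omega>. \<integral>\<^sup>+\<omega>'. f (\<omega>' t) \<partial>eP t \<omega> \<partial>C 0 t ?u)"
    by (simp add: nn_integral_bind[OF fc eP])
  also have "\<dots> = (\<integral>\<^sup>+\<omega>. \<integral>\<^sup>+x. f x \<partial>P t \<omega> \<partial>C 0 t ?u)"
    by (intro nn_integral_cong) (simp add: sp nn_integral_eP fc)
  finally show ?thesis .
qed

end

section \<open>State distributions of the controlled chain as marginals of the trajectory\<close>

text \<open>The law of \<open>x\<^sub>t\<close>, kept as a discrete distribution so that later
  computations become finite sums instead of integrals over trajectories.\<close>

primrec state_pmf :: "('x \<Rightarrow> 'a \<Rightarrow> 'x pmf) \<Rightarrow> ('x \<Rightarrow> 'a pmf) \<Rightarrow> 'x pmf \<Rightarrow> nat \<Rightarrow> 'x pmf" where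
  "state_pmf P \<pi> \<nu> 0 = \<nu>"
| "state_pmf P \<pi> \<nu> (Suc t) = bind_pmf (state_pmf P \<pi> \<nu> t) (\<lambda>x. bind_pmf (\<pi> x) (P x))"

text \<open>Puts the law of the state-action pair in the form in which \<open>step_kernel\<close>
  extends a trajectory, for the induction in \<open>nn_integral_trajectory\<close>.\<close>

lemma with_action_state_pmf_Suc:
  "with_action \<pi> (state_pmf P \<pi> \<nu> (Suc t))
    = bind_pmf (with_action \<pi> (state_pmf P \<pi> \<nu> t)) (\<lambda>z. with_action \<pi> (P (fst z) (snd z)))"
  by (simp add: with_action_def bind_assoc_pmf bind_map_pmf)

context
  fixes P :: "'x::finite \<Rightarrow> 'a::finite \<Rightarrow> 'x pmf" and \<nu> :: "'x pmf" and \<pi> :: "'x \<Rightarrow> 'a pmf"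
begin

interpretation IT: Ionescu_Tulcea "step_kernel P \<nu> \<pi>" "\<lambda>_. count_space UNIV"
  by (rule Ionescu_Tulcea_step_kernel)

lemma nn_integral_trajectory:
  "(\<integral>\<^sup>+\<omega>. f (\<omega> t) \<partial>trajectory P \<nu> \<pi>)
    = (\<integral>\<^sup>+z. f z \<partial>measure_pmf (with_action \<pi> (state_pmf P \<pi> \<nu> t)))"
proof -
  have "(\<integral>\<^sup>+\<omega>. f (\<omega> t) \<partial>IT.C 0 (Suc t) (\<lambda>_. undefined))
      = (\<integral>\<^sup>+z. f z \<partial>measure_pmf (with_action \<pi> (state_pmf P \<pi> \<nu> t)))"
  proof (induction t arbitrary: f)
    case 0
    show ?case
      by (subst IT.nn_integral_C_coordinate) (simp_all add: space_PiM sets_PiM_empty)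
  next
    case (Suc t)
    \<comment> \<open>The kernel at time \<open>Suc t\<close> reads the past only through coordinate
      \<open>t\<close>, so the inner integral is again a function of that coordinate. The induction
      hypothesis, general in \<open>f\<close>, applies to it.\<close>
    show ?case
      by (subst IT.nn_integral_C_coordinate)
        (simp_all add: Suc.IH[of "\<lambda>z. \<integral>\<^sup>+x. f x \<partial>measure_pmf (with_action \<pi> (P (fst z) (snd z)))"]
          with_action_state_pmf_Suc del: state_pmf.simps IT.C.simps)
  qed
  then show ?thesis
    unfolding trajectory_def by (subst IT.nn_integral_lim_coordinate) simp_all
qed

lemma sets_trajectory: "sets (trajectory P \<nu> \<pi>) = sets (PiM UNIV (\<lambda>_. count_space UNIV))"
  by (simp add: trajectory_def IT.PF.sets_lim)

lemma measurable_trajectory_coordinate: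
  "(\<lambda>\<omega>. \<omega> t) \<in> measurable (trajectory P \<nu> \<pi>) (count_space UNIV)"
  by (simp add: measurable_cong_sets[OF sets_trajectory refl])

lemma distr_trajectory:
  "distr (trajectory P \<nu> \<pi>) (count_space UNIV) (\<lambda>\<omega>. \<omega> t)
    = measure_pmf (with_action \<pi> (state_pmf P \<pi> \<nu> t))"
proof (rule measure_eqI)
  fix A :: "('x \<times> 'a) set"
  have "emeasure (distr (trajectory P \<nu> \<pi>) (count_space UNIV) (\<lambda>\<omega>. \<omega> t)) A
      = (\<integral>\<^sup>+z. indicator A z \<partial>distr (trajectory P \<nu> \<pi>) (count_space UNIV) (\<lambda>\<omega>. \<omega> t))"
    by simp
  also have "\<dots> = (\<integral>\<^sup>+\<omega>. indicator A (\<omega> t) \<partial>trajectory P \<nu> \<pi>)"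
    by (rule nn_integral_distr[OF measurable_trajectory_coordinate]) simp
  also have "\<dots> = emeasure (measure_pmf (with_action \<pi> (state_pmf P \<pi> \<nu> t))) A"
    by (subst nn_integral_trajectory) simp
  finally show "emeasure (distr (trajectory P \<nu> \<pi>) (count_space UNIV) (\<lambda>\<omega>. \<omega> t)) A
      = emeasure (measure_pmf (with_action \<pi> (state_pmf P \<pi> \<nu> t))) A" .
qed simp

text \<open>Total mass is preserved under images, so it can be read off from the marginal at time
  0.\<close>

lemma prob_space_trajectory: "prob_space (trajectory P \<nu> \<pi>)"
  by (rule prob_space_distrD[OF measurable_trajectory_coordinate[of 0]])
    (simp add: distr_trajectory prob_space_measure_pmf)

lemma expectation_trajectory:
  fixes f :: "'x \<times> 'a \<Rightarrow> real"
  shows "(\<integral>\<omega>. f (\<omega> t) \<partial>trajectory P \<nu> \<pi>)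
    = (\<Sum>x\<in>UNIV. pmf (state_pmf P \<pi> \<nu> t) x * (\<Sum>a\<in>UNIV. pmf (\<pi> x) a * f (x, a)))"
proof -
  have "(\<integral>\<omega>. f (\<omega> t) \<partial>trajectory P \<nu> \<pi>)
      = measure_pmf.expectation (with_action \<pi> (state_pmf P \<pi> \<nu> t)) f"
    by (subst distr_trajectory[symmetric], subst integral_distr)
      (auto intro: measurable_trajectory_coordinate)
  also have "\<dots> = (\<Sum>x\<in>UNIV. pmf (state_pmf P \<pi> \<nu> t) x * (\<Sum>a\<in>UNIV. pmf (\<pi> x) a * f (x, a)))"
    unfolding with_action_def
    by (subst pmf_expectation_bind[of UNIV], simp_all only: integral_map_pmf)
      (simp_all add: integral_measure_pmf[of UNIV])
  finally show ?thesis .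
qed

lemma prob_trajectory_state:
  "\<P>(\<omega> in trajectory P \<nu> \<pi>. fst (\<omega> t) = x) = pmf (state_pmf P \<pi> \<nu> t) x"
proof -
  have "\<P>(\<omega> in trajectory P \<nu> \<pi>. fst (\<omega> t) = x)
      = measure (distr (trajectory P \<nu> \<pi>) (count_space UNIV) (\<lambda>\<omega>. \<omega> t)) {z. fst z = x}"
    by (subst measure_distr[OF measurable_trajectory_coordinate])
      (auto intro!: arg_cong[where f = "measure _"])
  also have "\<dots> = measure_pmf.prob (map_pmf fst (with_action \<pi> (state_pmf P \<pi> \<nu> t))) {x}"
    by (simp add: distr_trajectory vimage_def)
  also have "map_pmf fst (with_action \<pi> (state_pmf P \<pi> \<nu> t)) = state_pmf P \<pi> \<nu> t"
    by (simp add: with_action_def map_bind_pmf pmf.map_comp o_def bind_return_pmf')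
  finally show ?thesis
    by (simp add: measure_pmf_single)
qed

end

section \<open>Invertibility of discounted stochastic matrices\<close>

text \<open>Maximum principle: for a square matrix a trivial kernel suffices, and at an index where
  \<open>\<bar>v\<bar>\<close> attains its maximum \<open>m\<close> the equation
  \<open>v = \<gamma> A v\<close> gives \<open>m \<le> \<gamma> m\<close>, because the rows of
  \<open>A\<close> are probability vectors.\<close>

lemma invertible_mat_1_minus_stochastic:
  fixes A :: "real^'n^'n"
  assumes nonneg: "\<And>i j. 0 \<le> A $ i $ j" and rows: "\<And>i. (\<Sum>j\<in>UNIV. A $ i $ j) = 1"
    and "0 \<le> \<gamma>" "\<gamma> < 1"
  shows "invertible (mat 1 - \<gamma> *\<^sub>R A)"
  unfolding invertible_left_inverse matrix_left_invertible_ker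
proof (intro allI impI)
  fix v :: "real^'n"
  assume "(mat 1 - \<gamma> *\<^sub>R A) *v v = 0"
  then have v: "v = \<gamma> *\<^sub>R (A *v v)"
    by (simp add: matrix_vector_mult_diff_rdistrib scaleR_matrix_vector_assoc)
  define m where "m = Max (range (\<lambda>i. \<bar>v $ i\<bar>))"
  have le: "\<bar>v $ i\<bar> \<le> m" for i
    unfolding m_def by (intro Max_ge) auto
  have "m \<in> range (\<lambda>i. \<bar>v $ i\<bar>)"
    unfolding m_def by (intro Max_in) auto
  then obtain i where i: "m = \<bar>v $ i\<bar>"
    by auto
  have "v $ i = \<gamma> * (\<Sum>j\<in>UNIV. A $ i $ j * v $ j)"
    by (subst v) (simp add: matrix_vector_mult_def)
  then have "m = \<gamma> * \<bar>\<Sum>j\<in>UNIV. A $ i $ j * v $ j\<bar>"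
    using i \<open>0 \<le> \<gamma>\<close> by (simp add: abs_mult)
  also have "\<dots> \<le> \<gamma> * (\<Sum>j\<in>UNIV. A $ i $ j * m)"
    using \<open>0 \<le> \<gamma>\<close> nonneg le
    by (intro mult_left_mono order_trans[OF sum_abs] sum_mono) (auto simp: abs_mult intro!: mult_left_mono)
  also have "\<dots> = \<gamma> * m"
    by (simp add: sum_distrib_right[symmetric] rows)
  finally have "(1 - \<gamma>) * m \<le> 0"
    by (simp add: algebra_simps)
  then have "m \<le> 0"
    using \<open>\<gamma> < 1\<close> by (simp add: mult_le_0_iff)
  then show "v = 0"
    using le by (auto simp: vec_eq_iff) (metis abs_le_zero_iff order_trans)
qed

section \<open>The one-norm and the ergodicity coefficient\<close>

lemma norm1_scaleR: "norm1 (c *\<^sub>R v) = \<bar>c\<bar> * norm1 v"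
  by (simp add: norm1_def abs_mult sum_distrib_left)

lemma norm1_nonneg: "0 \<le> norm1 v"
  by (simp add: norm1_def sum_nonneg)

lemma norm1_eq_0: "norm1 v = 0 \<longleftrightarrow> v = 0"
  by (auto simp: norm1_def sum_nonneg_eq_0_iff vec_eq_iff)

lemma tau1_nonneg: "0 \<le> tau1 A"
proof (cases "ergodicity_set A = {}")
  case False
  then show ?thesis
    using tau1_in_ergodicity_set(1)[of A] by (auto simp: ergodicity_set_def norm1_nonneg)
qed (simp add: tau1_def)

text \<open>By homogeneity a nonzero \<open>z\<close> can be rescaled to an admissible unit vector.
  In dimension one the sum condition forces \<open>z = 0\<close>, so the default value of
  \<open>tau1\<close> does no harm.\<close>

lemma norm1_vector_matrix_le_tau1:
  fixes z :: "real^'n" and D :: "real^'n^'n"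
  assumes "z \<bullet> 1 = 0"
  shows "norm1 (z v* D) \<le> tau1 D * norm1 z"
proof (cases "z = 0")
  case True
  then show ?thesis
    by (simp add: norm1_def)
next
  case False
  then have pos: "0 < norm1 z"
    using norm1_nonneg[of z] norm1_eq_0[of z] by linarith
  let ?x = "(1 / norm1 z) *\<^sub>R z"
  have "norm1 (transpose D *v ?x) \<in> ergodicity_set D"
    unfolding ergodicity_set_def using assms pos by (auto simp: norm1_scaleR intro!: exI[of _ ?x])
  then have "norm1 (transpose D *v ?x) \<le> tau1 D"
    using tau1_in_ergodicity_set(2)[of D] by blast
  then show ?thesis
    using pos by (simp add: scaleR_vector_matrix_assoc norm1_scaleR field_simps)
qed

section \<open>Rank-one matrices and the group inverse\<close>

text \<open>This is the rank-one matrix \<open>e u\<^sup>T\<close>.\<close>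

definition const_rows :: "real^'n \<Rightarrow> real^'n^'n" where
  "const_rows u = (\<chi> i j. u $ j)"

lemma const_rows_mult: "const_rows u ** B = const_rows (u v* B)"
  by (simp add: const_rows_def matrix_matrix_mult_def vector_matrix_mult_def vec_eq_iff mult.commute)

lemma mult_const_rows:
  assumes "B *v 1 = c *\<^sub>R 1"
  shows "B ** const_rows u = c *\<^sub>R const_rows u"
proof -
  have "(\<Sum>j\<in>UNIV. B $ i $ j) = c" for i
    using arg_cong[OF assms, of "\<lambda>v. v $ i"] by (simp add: matrix_vector_mult_def)
  then show ?thesis
    by (simp add: const_rows_def matrix_matrix_mult_def vec_eq_iff sum_distrib_right[symmetric])
qed

lemma vector_mult_const_rows: "v v* const_rows u = (v \<bullet> 1) *\<^sub>R u"
  by (simp add: const_rows_def vector_matrix_mult_def vec_eq_iff inner_vec_def sum_distrib_left mult.commute)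

lemma const_rows_scaleR: "const_rows (c *\<^sub>R u) = c *\<^sub>R const_rows u"
  by (simp add: const_rows_def vec_eq_iff)

lemma matrix_mult_diff_left: "(A - B) ** C = A ** C - B ** (C :: real^'n^'n)"
  by (simp add: matrix_matrix_mult_def vec_eq_iff left_diff_distrib sum_subtractf)

lemma matrix_mult_diff_right: "C ** (A - B) = C ** A - C ** (B :: real^'n^'n)"
  by (simp add: matrix_matrix_mult_def vec_eq_iff right_diff_distrib sum_subtractf)

text \<open>With \<open>Q = I - e d\<^sup>T\<close>, the group inverse is \<open>Q M\<^sup>-\<^sup>1 Q\<close>.\<close>

lemma group_inverse_rank_one_update:
  fixes M :: "real^'n^'n"
  assumes inv: "invertible M" and Me: "M *v 1 = c *\<^sub>R 1"
    and dM: "d v* M = c *\<^sub>R \<mu>" and sums: "\<mu> \<bullet> 1 = 1" "d \<bullet> 1 = 1"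
  defines "A \<equiv> M - c *\<^sub>R const_rows \<mu>"
  shows "A ** group_inverse A = mat 1 - const_rows d"
proof -
  obtain N where MN: "M ** N = mat 1" and NM: "N ** M = mat 1"
    using inv by (auto simp: invertible_def)
  define E where "E = const_rows \<mu>"
  define F where "F = const_rows d"
  define Q where "Q = mat 1 - F"
  define D where "D = Q ** N ** Q"
  have ME: "M ** E = c *\<^sub>R E" and MF: "M ** F = c *\<^sub>R F"
    unfolding E_def F_def by (rule mult_const_rows[OF Me])+
  have FM: "F ** M = c *\<^sub>R E"
    by (simp add: E_def F_def const_rows_mult dM const_rows_scaleR)
  have EF: "E ** F = F" and FF: "F ** F = F" and FE: "F ** E = E"
    by (simp_all add: E_def F_def const_rows_mult vector_mult_const_rows sums)
  have A: "A = M - c *\<^sub>R E"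
    by (simp add: A_def E_def)
  \<comment> \<open>\<open>A\<close> annihilates \<open>e\<close> on the right and \<open>d\<close>
    on the left, so \<open>Q\<close> acts as the identity on \<open>A\<close> from both
    sides.\<close>
  have AF: "A ** F = 0"
    by (simp add: A matrix_mult_diff_left MF EF scalar_matrix_assoc[symmetric])
  have FA: "F ** A = 0"
    by (simp add: A matrix_mult_diff_right FM FE matrix_scalar_ac scalar_matrix_assoc[symmetric])
  \<comment> \<open>Since \<open>F ** M = c *\<^sub>R E\<close>, this evaluates the rank-one part of
    \<open>A ** N\<close> as \<open>F\<close>.\<close>
  have "F ** M ** N = F"
    by (simp add: matrix_mul_assoc[symmetric] MN)
  then have AN: "A ** N = Q"
    by (simp add: A Q_def matrix_mult_diff_left MN FM)
  have "N ** (M ** E) = E"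
    by (simp add: matrix_mul_assoc NM)
  then have NA: "N ** A = mat 1 - E"
    by (simp add: A matrix_mult_diff_right NM ME matrix_scalar_ac scalar_matrix_assoc[symmetric])
  have AQ: "A ** Q = A" and QA: "Q ** A = A" and QQ: "Q ** Q = Q"
    by (simp_all add: Q_def matrix_mult_diff_left matrix_mult_diff_right AF FA FF)
  have AD: "A ** D = Q"
    by (simp add: D_def matrix_mul_assoc AQ AN QQ)
  have "D ** A = Q ** (N ** A)"
    by (simp add: D_def matrix_mul_assoc[symmetric] QA)
  \<comment> \<open>\<open>Q ** E = E - F ** E = 0\<close>, so the term \<open>E\<close> in
    \<open>N ** A\<close> disappears.\<close>
  also have "\<dots> = Q"
    by (simp add: NA Q_def matrix_mult_diff_left matrix_mult_diff_right FE)
  finally have DA: "D ** A = Q" .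
  have "Q ** D = D"
    by (simp add: D_def matrix_mul_assoc QQ)
  then have "is_group_inverse A D"
    by (simp add: is_group_inverse_def AD DA QA)
  then have "group_inverse A = D"
    unfolding group_inverse_def by (intro the_equality) (auto intro: is_group_inverse_unique)
  then show ?thesis
    using AD by (simp add: Q_def F_def)
qed

section \<open>Discounted occupation vectors and the value function\<close>

lemma trans_mat_nonneg: "0 \<le> trans_mat P \<pi> $ x $ y"
  by (auto simp: trans_mat_def intro!: sum_nonneg)

lemma trans_mat_row_sum: "(\<Sum>y\<in>UNIV. trans_mat P \<pi> $ x $ y) = 1"
proof -
  have "(\<Sum>y\<in>UNIV. trans_mat P \<pi> $ x $ y) = (\<Sum>a\<in>UNIV. pmf (\<pi> x) a * (\<Sum>y\<in>UNIV. pmf (P x a) y))"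
    unfolding trans_mat_def by (simp add: sum_distrib_left) (rule sum.swap)
  then show ?thesis
    by (simp add: sum_pmf_eq_1)
qed

lemma trans_mat_mult_ones: "trans_mat P \<pi> *v 1 = 1"
  by (simp add: matrix_vector_mult_def vec_eq_iff trans_mat_row_sum)

abbreviation bellman_mat ::
    "('x::finite \<Rightarrow> 'a::finite \<Rightarrow> 'x pmf) \<Rightarrow> real \<Rightarrow> ('x \<Rightarrow> 'a pmf) \<Rightarrow> real^'x^'x" where
  "bellman_mat P \<gamma> \<pi> \<equiv> mat 1 - \<gamma> *\<^sub>R trans_mat P \<pi>"

definition pmf_vec :: "'x::finite pmf \<Rightarrow> real^'x" where
  "pmf_vec \<nu> = (\<chi> x. pmf \<nu> x)"

text \<open>The unnormalised series of \<open>\<gamma>\<close>-discounted state laws. The start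
  \<open>\<nu>\<close> is left free: \<open>\<mu>\<close> yields \<open>disc_d\<close> up to the
  factor \<open>1 - \<gamma>\<close>, and a point mass yields \<open>disc_V\<close>.\<close>

definition occupation ::
    "('x::finite \<Rightarrow> 'a::finite \<Rightarrow> 'x pmf) \<Rightarrow> real \<Rightarrow> ('x \<Rightarrow> 'a pmf) \<Rightarrow> 'x pmf \<Rightarrow> real^'x" where
  "occupation P \<gamma> \<pi> \<nu> = (\<chi> x. \<Sum>t. \<gamma> ^ t * pmf (state_pmf P \<pi> \<nu> t) x)"

lemma pmf_state_pmf_Suc:
  fixes P :: "'x::finite \<Rightarrow> 'a::finite \<Rightarrow> 'x pmf"
  shows "pmf (state_pmf P \<pi> \<nu> (Suc t)) y
    = (\<Sum>x\<in>UNIV. pmf (state_pmf P \<pi> \<nu> t) x * trans_mat P \<pi> $ x $ y)"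
  by (simp add: pmf_bind integral_measure_pmf[of UNIV] trans_mat_def)

context
  fixes P :: "'x::finite \<Rightarrow> 'a::finite \<Rightarrow> 'x pmf" and \<gamma> :: real
  assumes \<gamma>: "0 \<le> \<gamma>" "\<gamma> < 1"
begin

lemma invertible_bellman_mat: "invertible (bellman_mat P \<gamma> \<pi>)"
  by (intro invertible_mat_1_minus_stochastic trans_mat_nonneg trans_mat_row_sum \<gamma>)

lemma summable_discounted_pmf: "summable (\<lambda>t. \<gamma> ^ t * pmf (q t) z)"
  by (rule summable_comparison_test'[OF summable_geometric[of \<gamma>]])
    (use \<gamma> in \<open>auto simp: mult_left_le pmf_le_1\<close>)

text \<open>Multiplying by \<open>\<gamma>\<close> and the transition matrix shifts the series by
  one step, so the difference telescopes to its term at \<open>t = 0\<close>.\<close>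

lemma occupation_bellman_mat: "occupation P \<gamma> \<pi> \<nu> v* bellman_mat P \<gamma> \<pi> = pmf_vec \<nu>"
proof -
  let ?s = "state_pmf P \<pi> \<nu>" and ?T = "trans_mat P \<pi>" and ?o = "occupation P \<gamma> \<pi> \<nu>"
  have o: "(\<lambda>t. \<gamma> ^ t * pmf (?s t) x) sums (?o $ x)" for x
    by (simp add: occupation_def summable_sums[OF summable_discounted_pmf])
  have "\<gamma> * (?o v* ?T) $ y = ?o $ y - pmf \<nu> y" for y
  proof -
    have "(\<lambda>t. \<Sum>x\<in>UNIV. \<gamma> * ?T $ x $ y * (\<gamma> ^ t * pmf (?s t) x)) sums
        (\<Sum>x\<in>UNIV. \<gamma> * ?T $ x $ y * ?o $ x)"
      by (intro sums_sum sums_mult o)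
    also have "(\<lambda>t. \<Sum>x\<in>UNIV. \<gamma> * ?T $ x $ y * (\<gamma> ^ t * pmf (?s t) x))
        = (\<lambda>t. \<gamma> ^ Suc t * pmf (?s (Suc t)) y)"
      unfolding pmf_state_pmf_Suc by (simp add: sum_distrib_left mult_ac del: state_pmf.simps)
    also have "(\<Sum>x\<in>UNIV. \<gamma> * ?T $ x $ y * ?o $ x) = \<gamma> * (?o v* ?T) $ y"
      by (simp add: vector_matrix_mult_def sum_distrib_left mult_ac)
    finally have "(\<lambda>t. \<gamma> ^ Suc t * pmf (?s (Suc t)) y) sums (\<gamma> * (?o v* ?T) $ y)" .
    then have "(\<lambda>t. \<gamma> ^ t * pmf (?s t) y) sums (\<gamma> * (?o v* ?T) $ y + \<gamma> ^ 0 * pmf (?s 0) y)"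
      by (rule sums_Suc)
    then have "\<gamma> * (?o v* ?T) $ y + \<gamma> ^ 0 * pmf (?s 0) y = ?o $ y"
      using o sums_unique2 by blast
    then show ?thesis
      by simp
  qed
  then show ?thesis
    by (simp add: vec_eq_iff pmf_vec_def vector_matrix_mult_diff_rdistrib vector_scaleR_matrix_ac)
qed

text \<open>The discounted costs are dominated by a geometric series, so expectation and sum over
  time may be exchanged; each term then depends on one marginal only.\<close>

lemma disc_V_occupation:
  "disc_V P g \<gamma> \<pi> x = occupation P \<gamma> \<pi> (return_pmf x) \<bullet> (\<chi> y. \<Sum>a\<in>UNIV. pmf (\<pi> y) a * g y a)"
proof -
  let ?tr = "trajectory P (return_pmf x) \<pi>" and ?s = "state_pmf P \<pi> (return_pmf x)"
  let ?r = "\<lambda>y. \<Sum>a\<in>UNIV. pmf (\<pi> y) a * g y a"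
  let ?f = "\<lambda>t (\<omega> :: nat \<Rightarrow> 'x \<times> 'a). \<gamma> ^ t * g (fst (\<omega> t)) (snd (\<omega> t))"
  interpret prob_space ?tr
    by (rule prob_space_trajectory)
  \<comment> \<open>A crude bound on the cost, finite because states and actions are.\<close>
  define B where "B = (\<Sum>z\<in>UNIV. \<bar>g (fst z) (snd z)\<bar>)"
  have "\<bar>g (fst z) (snd z)\<bar> \<le> B" for z
    unfolding B_def by (rule member_le_sum) auto
  then have bound: "norm (?f t \<omega>) \<le> \<gamma> ^ t * B" for t \<omega>
    using \<gamma> by (auto simp: abs_mult intro!: mult_left_mono)
  have geo: "summable (\<lambda>t. \<gamma> ^ t * B)"
    using \<gamma> by (intro summable_mult2 summable_geometric) auto
  have meas: "?f t \<in> borel_measurable ?tr" for t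
    using measurable_compose[OF measurable_trajectory_coordinate, of "\<lambda>z. \<gamma> ^ t * g (fst z) (snd z)" borel]
    by simp
  have int: "integrable ?tr (?f t)" for t
    by (rule integrable_const_bound[OF _ meas]) (use bound in auto)
  have "disc_V P g \<gamma> \<pi> x = (\<Sum>t. \<integral>\<omega>. ?f t \<omega> \<partial>?tr)"
    unfolding disc_V_def
  proof (rule integral_suminf[OF int])
    show "AE \<omega> in ?tr. summable (\<lambda>t. norm (?f t \<omega>))"
      by (intro AE_I2 summable_comparison_test'[OF geo]) (use bound in auto)
    have "(\<integral>\<omega>. norm (?f t \<omega>) \<partial>?tr) \<le> (\<integral>\<omega>. \<gamma> ^ t * B \<partial>?tr)" for t
      by (intro integral_mono integrable_norm int bound) simp
    then show "summable (\<lambda>t. \<integral>\<omega>. norm (?f t \<omega>) \<partial>?tr)"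
      by (intro summable_comparison_test'[OF geo]) (simp add: prob_space)
  qed
  also have "\<dots> = (\<Sum>t. \<Sum>y\<in>UNIV. \<gamma> ^ t * pmf (?s t) y * ?r y)"
    using expectation_trajectory[where f = "\<lambda>z. g (fst z) (snd z)"]
    by (simp add: sum_distrib_left mult_ac)
  also have "\<dots> = (\<Sum>y\<in>UNIV. \<Sum>t. \<gamma> ^ t * pmf (?s t) y * ?r y)"
    by (intro suminf_sum summable_mult2 summable_discounted_pmf)
  also have "\<dots> = (\<Sum>y\<in>UNIV. (\<Sum>t. \<gamma> ^ t * pmf (?s t) y) * ?r y)"
    by (simp add: suminf_mult2[OF summable_discounted_pmf])
  finally show ?thesis
    by (simp add: occupation_def inner_vec_def)
qed

text \<open>The occupation vector started at \<open>x\<close> is row \<open>x\<close> of the inverse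
  Bellman matrix, so the value vector is that inverse applied to the one-step cost.\<close>

lemma bellman_mat_disc_V:
  "bellman_mat P \<gamma> \<pi> *v (\<chi> x. disc_V P g \<gamma> \<pi> x) = (\<chi> y. \<Sum>a\<in>UNIV. pmf (\<pi> y) a * g y a)"
proof -
  let ?M = "bellman_mat P \<gamma> \<pi>" and ?r = "\<chi> y. \<Sum>a\<in>UNIV. pmf (\<pi> y) a * g y a"
  obtain N where MN: "?M ** N = mat 1"
    using invertible_bellman_mat by (auto simp: invertible_def)
  have "disc_V P g \<gamma> \<pi> x = (N *v ?r) $ x" for x
  proof -
    have "occupation P \<gamma> \<pi> (return_pmf x) = occupation P \<gamma> \<pi> (return_pmf x) v* ?M v* N"
      by (simp add: vector_matrix_mul_assoc MN)
    also have "\<dots> = axis x 1 v* N"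
      unfolding occupation_bellman_mat
      by (rule arg_cong[where f = "\<lambda>v. v v* N"]) (auto simp: pmf_vec_def axis_def vec_eq_iff)
    finally show ?thesis
      by (simp add: disc_V_occupation dot_lmul_matrix inner_axis')
  qed
  then have "(\<chi> x. disc_V P g \<gamma> \<pi> x) = N *v ?r"
    by (simp add: vec_eq_iff)
  then show ?thesis
    by (simp add: matrix_vector_mul_assoc MN)
qed

lemma disc_d_occupation: "(\<chi> x. disc_d P \<mu> \<gamma> \<pi> x) = (1 - \<gamma>) *\<^sub>R occupation P \<gamma> \<pi> \<mu>"
  by (simp add: vec_eq_iff disc_d_def occupation_def prob_trajectory_state)

lemma disc_d_bellman_mat:
  "(\<chi> x. disc_d P \<mu> \<gamma> \<pi> x) v* bellman_mat P \<gamma> \<pi> = (1 - \<gamma>) *\<^sub>R pmf_vec \<mu>"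
  by (simp add: disc_d_occupation scaleR_vector_matrix_assoc occupation_bellman_mat)

lemma disc_d_nonneg: "0 \<le> disc_d P \<mu> \<gamma> \<pi> x"
  unfolding disc_d_def prob_trajectory_state
  using \<gamma> by (intro mult_nonneg_nonneg suminf_nonneg summable_discounted_pmf) auto

lemma bellman_mat_mult_ones: "bellman_mat P \<gamma> \<pi> *v 1 = (1 - \<gamma>) *\<^sub>R 1"
  by (simp add: matrix_vector_mult_diff_rdistrib scaleR_matrix_vector_assoc[symmetric]
      trans_mat_mult_ones scaleR_diff_left)

lemma pmf_vec_ones: "pmf_vec \<nu> \<bullet> 1 = 1" for \<nu> :: "'x pmf"
  by (simp add: pmf_vec_def inner_vec_def sum_pmf_eq_1)

text \<open>Pair \<open>disc_d_bellman_mat\<close> with the all-ones vector, an eigenvector of the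
  Bellman matrix for \<open>1 - \<gamma> > 0\<close>, and cancel the eigenvalue.\<close>

lemma disc_d_ones: "(\<chi> x. disc_d P \<mu> \<gamma> \<pi> x) \<bullet> 1 = 1"
proof -
  let ?d = "\<chi> x. disc_d P \<mu> \<gamma> \<pi> x"
  have "(1 - \<gamma>) * (?d \<bullet> 1) = ?d \<bullet> (bellman_mat P \<gamma> \<pi> *v 1)"
    by (simp add: bellman_mat_mult_ones)
  also have "\<dots> = (1 - \<gamma>) * (pmf_vec \<mu> \<bullet> 1)"
    by (simp only: dot_lmul_matrix[symmetric] disc_d_bellman_mat inner_scaleR_left)
  finally show ?thesis
    using \<gamma> by (simp add: pmf_vec_ones)
qed

lemma disc_eta_eq:
  "disc_eta P g \<mu> \<gamma> \<pi> = (1 - \<gamma>) * (pmf_vec \<mu> \<bullet> (\<chi> x. disc_V P g \<gamma> \<pi> x))"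
  by (simp add: disc_eta_def integral_measure_pmf[of UNIV] pmf_vec_def inner_vec_def)

text \<open>Averaging over \<open>\<pi>2\<close> turns the transition term of \<open>disc_Q\<close>
  into the transition matrix of \<open>\<pi>2\<close>, which exposes the advantage as a Bellman
  residual of the old value.\<close>

lemma expectation_disc_A:
  "(\<chi> x. measure_pmf.expectation (\<pi>2 x) (disc_A P g \<gamma> \<pi>1 x))
    = (\<chi> x. \<Sum>a\<in>UNIV. pmf (\<pi>2 x) a * g x a) - bellman_mat P \<gamma> \<pi>2 *v (\<chi> x. disc_V P g \<gamma> \<pi>1 x)"
proof -
  let ?V = "disc_V P g \<gamma> \<pi>1"
  have "measure_pmf.expectation (\<pi>2 x) (disc_A P g \<gamma> \<pi>1 x)
      = (\<Sum>a\<in>UNIV. pmf (\<pi>2 x) a * g x a) - (?V x - \<gamma> * (\<Sum>y\<in>UNIV. trans_mat P \<pi>2 $ x $ y * ?V y))" for x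
  proof -
    have "(\<Sum>y\<in>UNIV. trans_mat P \<pi>2 $ x $ y * ?V y)
        = (\<Sum>a\<in>UNIV. pmf (\<pi>2 x) a * (\<Sum>y\<in>UNIV. pmf (P x a) y * ?V y))"
      unfolding trans_mat_def
      by (simp add: sum_distrib_left sum_distrib_right mult_ac) (rule sum.swap)
    moreover have "(\<Sum>a\<in>UNIV. pmf (\<pi>2 x) a * ?V x) = ?V x"
      by (simp add: sum_distrib_right[symmetric] sum_pmf_eq_1)
    ultimately show ?thesis
      by (simp add: disc_A_def disc_Q_def integral_measure_pmf[of UNIV] algebra_simps sum.distrib
          sum_subtractf sum_distrib_left)
  qed
  then show ?thesis
    by (simp add: vec_eq_iff matrix_vector_mult_diff_rdistrib scaleR_matrix_vector_assoc[symmetric])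
      (simp add: matrix_vector_mult_def)
qed

section \<open>Return differences and perturbation of the occupation distribution\<close>

text \<open>As \<open>d\<^sub>2 M\<^sub>2 = (1 - \<gamma>) \<mu>\<close>, both returns are
  \<open>d\<^sub>2 M\<^sub>2 V\<^sub>i\<close> with the same \<open>d\<^sub>2\<close>; after
  \<open>M\<^sub>2 V\<^sub>2 = r\<^sub>2\<close> the residual
  \<open>r\<^sub>2 - M\<^sub>2 V\<^sub>1\<close> remains.\<close>

lemma performance_difference:
  "disc_eta P g \<mu> \<gamma> \<pi>2 - disc_eta P g \<mu> \<gamma> \<pi>1
    = (\<chi> x. disc_d P \<mu> \<gamma> \<pi>2 x) \<bullet> (\<chi> x. measure_pmf.expectation (\<pi>2 x) (disc_A P g \<gamma> \<pi>1 x))"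
proof -
  have "disc_eta P g \<mu> \<gamma> \<pi>
      = (\<chi> x. disc_d P \<mu> \<gamma> \<pi>2 x) \<bullet> (bellman_mat P \<gamma> \<pi>2 *v (\<chi> x. disc_V P g \<gamma> \<pi> x))" for \<pi>
    by (simp only: dot_lmul_matrix[symmetric] disc_d_bellman_mat disc_eta_eq inner_scaleR_left)
  then show ?thesis
    by (simp add: expectation_disc_A inner_diff_right bellman_mat_disc_V)
qed

lemma disc_d_diff:
  "(\<chi> x. disc_d P \<mu> \<gamma> \<pi>2 x) - (\<chi> x. disc_d P \<mu> \<gamma> \<pi>1 x)
    = \<gamma> *\<^sub>R ((\<chi> x. disc_d P \<mu> \<gamma> \<pi>1 x) v* (trans_mat P \<pi>2 - trans_mat P \<pi>1) v* disc_D P \<mu> \<gamma> \<pi>2)"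
proof -
  let ?d1 = "\<chi> x. disc_d P \<mu> \<gamma> \<pi>1 x" and ?d2 = "\<chi> x. disc_d P \<mu> \<gamma> \<pi>2 x"
  let ?M1 = "bellman_mat P \<gamma> \<pi>1" and ?M2 = "bellman_mat P \<gamma> \<pi>2"
  \<comment> \<open>\<open>I\<close> minus the discounted matrix of \<open>\<pi>2\<close>, written
    as a rank-one update of its Bellman matrix with \<open>c = 1 - \<gamma>\<close>.\<close>
  define A where "A = ?M2 - (1 - \<gamma>) *\<^sub>R const_rows (pmf_vec \<mu>)"
  have "A = mat 1 - disc_mat P \<mu> \<gamma> \<pi>2"
    by (simp add: A_def disc_mat_def const_rows_def pmf_vec_def)
  then have "A ** disc_D P \<mu> \<gamma> \<pi>2 = A ** group_inverse A"
    by (simp add: disc_D_def)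
  also have "\<dots> = mat 1 - const_rows ?d2"
    unfolding A_def
    by (rule group_inverse_rank_one_update[OF invertible_bellman_mat bellman_mat_mult_ones
          disc_d_bellman_mat pmf_vec_ones disc_d_ones])
  finally have AD: "A ** disc_D P \<mu> \<gamma> \<pi>2 = mat 1 - const_rows ?d2" .
  have d2A: "?d2 v* A = 0"
    by (simp only: A_def vector_matrix_mult_diff_rdistrib[of _ "bellman_mat P \<gamma> \<pi>2"] disc_d_bellman_mat
        vector_scaleR_matrix_ac vector_mult_const_rows disc_d_ones scaleR_one diff_self)
  \<comment> \<open>Because \<open>?d1\<close> sums to one, the rank-one part contributes
    \<open>(1 - \<gamma>) \<mu>\<close>, which is also \<open>?d1 v* ?M1\<close>.\<close>
  have "?d1 v* A = ?d1 v* ?M2 - ?d1 v* ?M1"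
    by (simp only: A_def vector_matrix_mult_diff_rdistrib[of _ "bellman_mat P \<gamma> \<pi>2"] disc_d_bellman_mat
        vector_scaleR_matrix_ac vector_mult_const_rows disc_d_ones scaleR_one)
  also have "\<dots> = ?d1 v* (?M2 - ?M1)"
    by (simp only: vector_matrix_mult_diff_rdistrib)
  also have "?M2 - ?M1 = (- \<gamma>) *\<^sub>R (trans_mat P \<pi>2 - trans_mat P \<pi>1)"
    by (simp add: scaleR_diff_right)
  finally have "(?d2 - ?d1) v* A = \<gamma> *\<^sub>R (?d1 v* (trans_mat P \<pi>2 - trans_mat P \<pi>1))"
    by (simp only: vector_matrix_mult_diff_distrib d2A vector_scaleR_matrix_ac) simp
  \<comment> \<open>Both distributions sum to one, so \<open>const_rows ?d2\<close> annihilates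
    their difference.\<close>
  moreover have "(?d2 - ?d1) v* A v* disc_D P \<mu> \<gamma> \<pi>2 = ?d2 - ?d1"
    by (simp add: vector_matrix_mul_assoc AD vector_matrix_mult_diff_rdistrib
        vector_mult_const_rows inner_diff_left disc_d_ones)
  ultimately show ?thesis
    by (simp add: scaleR_vector_matrix_assoc)
qed

text \<open>Pushing the signed measure \<open>\<pi>2 - \<pi>1\<close> at \<open>x\<close> through
  the stochastic kernel \<open>P x\<close> does not increase its one-norm, which is twice the total
  variation; the nonnegative weights \<open>disc_d\<close> then average over
  \<open>x\<close>.\<close>

lemma norm1_disc_d_trans_mat_diff:
  "norm1 ((\<chi> x. disc_d P \<mu> \<gamma> \<pi>1 x) v* (trans_mat P \<pi>2 - trans_mat P \<pi>1))
    \<le> 2 * (\<Sum>x\<in>UNIV. disc_d P \<mu> \<gamma> \<pi>1 x * policy_TV \<pi>2 \<pi>1 x)"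
proof -
  let ?d = "disc_d P \<mu> \<gamma> \<pi>1" and ?T = "trans_mat P \<pi>2 - trans_mat P \<pi>1"
  have T: "(\<Sum>y\<in>UNIV. \<bar>?T $ x $ y\<bar>) \<le> 2 * policy_TV \<pi>2 \<pi>1 x" for x
  proof -
    have "(\<Sum>y\<in>UNIV. \<bar>?T $ x $ y\<bar>) = (\<Sum>y\<in>UNIV. \<bar>\<Sum>a\<in>UNIV. (pmf (\<pi>2 x) a - pmf (\<pi>1 x) a) * pmf (P x a) y\<bar>)"
      by (simp add: trans_mat_def sum_subtractf left_diff_distrib)
    also have "\<dots> \<le> (\<Sum>y\<in>UNIV. \<Sum>a\<in>UNIV. \<bar>pmf (\<pi>2 x) a - pmf (\<pi>1 x) a\<bar> * pmf (P x a) y)"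
      by (intro sum_mono order_trans[OF sum_abs]) (simp add: abs_mult)
    also have "\<dots> = (\<Sum>a\<in>UNIV. \<bar>pmf (\<pi>2 x) a - pmf (\<pi>1 x) a\<bar> * (\<Sum>y\<in>UNIV. pmf (P x a) y))"
      by (subst sum.swap) (simp add: sum_distrib_left)
    finally show ?thesis
      by (simp add: policy_TV_def sum_pmf_eq_1)
  qed
  have "norm1 ((\<chi> x. ?d x) v* ?T) \<le> (\<Sum>y\<in>UNIV. \<Sum>x\<in>UNIV. ?d x * \<bar>?T $ x $ y\<bar>)"
    unfolding norm1_def vector_matrix_mult_def
    by (auto intro!: sum_mono order_trans[OF sum_abs] simp: abs_mult disc_d_nonneg)
  also have "\<dots> = (\<Sum>x\<in>UNIV. ?d x * (\<Sum>y\<in>UNIV. \<bar>?T $ x $ y\<bar>))"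
    by (subst sum.swap) (simp add: sum_distrib_left)
  also have "\<dots> \<le> (\<Sum>x\<in>UNIV. ?d x * (2 * policy_TV \<pi>2 \<pi>1 x))"
    by (intro sum_mono mult_left_mono T disc_d_nonneg)
  finally show ?thesis
    by (simp add: sum_distrib_left mult_ac)
qed

end

section \<open>The bound on the difference of returns\<close>

theorem theorem3:
  fixes P :: "'x::finite \<Rightarrow> 'a::finite \<Rightarrow> 'x pmf"
    and g :: "'x \<Rightarrow> 'a \<Rightarrow> real"
    and \<mu> :: "'x pmf"
    and \<gamma> :: real
    and \<pi>1 \<pi>2 :: "'x \<Rightarrow> 'a pmf"
  assumes "unichain P"
    and "0 \<le> \<gamma>" and "\<gamma> < 1"
  shows "disc_eta P g \<mu> \<gamma> \<pi>2 - disc_eta P g \<mu> \<gamma> \<pi>1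
    \<le> (\<Sum>x\<in>UNIV. disc_d P \<mu> \<gamma> \<pi>1 x * measure_pmf.expectation (\<pi>2 x) (disc_A P g \<gamma> \<pi>1 x))
      + 2 * \<gamma> * disc_eps P g \<gamma> \<pi>1 \<pi>2 * tau1 (disc_D P \<mu> \<gamma> \<pi>2)
        * (\<Sum>x\<in>UNIV. disc_d P \<mu> \<gamma> \<pi>1 x * policy_TV \<pi>2 \<pi>1 x)"
proof -
  note \<gamma> = assms(2,3)
  define d1 d2 b where "d1 = (\<chi> x. disc_d P \<mu> \<gamma> \<pi>1 x)" and "d2 = (\<chi> x. disc_d P \<mu> \<gamma> \<pi>2 x)"
    and "b = (\<chi> x. measure_pmf.expectation (\<pi>2 x) (disc_A P g \<gamma> \<pi>1 x))"
  let ?eps = "disc_eps P g \<gamma> \<pi>1 \<pi>2" and ?tau = "tau1 (disc_D P \<mu> \<gamma> \<pi>2)"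
  let ?TV = "\<Sum>x\<in>UNIV. disc_d P \<mu> \<gamma> \<pi>1 x * policy_TV \<pi>2 \<pi>1 x"
  define z where "z = d1 v* (trans_mat P \<pi>2 - trans_mat P \<pi>1)"
  have b_le: "\<bar>b $ x\<bar> \<le> ?eps" for x
    by (auto simp: b_def disc_eps_def intro: Max_ge)
  then have eps: "0 \<le> ?eps"
    by (meson abs_ge_zero order_trans)
  \<comment> \<open>Both transition matrices fix the all-ones vector, so \<open>z\<close> qualifies
    for the ergodicity bound.\<close>
  have z0: "z \<bullet> 1 = 0"
    by (simp add: z_def dot_lmul_matrix matrix_vector_mult_diff_rdistrib trans_mat_mult_ones)
  have "norm1 (d2 - d1) = \<gamma> * norm1 (z v* disc_D P \<mu> \<gamma> \<pi>2)"
    using \<gamma>(1) by (simp add: d1_def d2_def z_def norm1_scaleR disc_d_diff[OF \<gamma>])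
  also have "\<dots> \<le> \<gamma> * (?tau * norm1 z)"
    by (intro mult_left_mono norm1_vector_matrix_le_tau1 z0 \<gamma>(1))
  also have "\<dots> \<le> \<gamma> * (?tau * (2 * ?TV))"
    unfolding z_def d1_def
    by (intro mult_left_mono norm1_disc_d_trans_mat_diff tau1_nonneg \<gamma>)
  finally have d_le: "norm1 (d2 - d1) \<le> \<gamma> * (?tau * (2 * ?TV))" .
  \<comment> \<open>Hoelder: one-norm of \<open>d2 - d1\<close> against the maximum norm of
    \<open>b\<close>.\<close>
  have "(d2 - d1) \<bullet> b \<le> (\<Sum>x\<in>UNIV. \<bar>(d2 - d1) $ x\<bar> * ?eps)"
    unfolding inner_vec_def
  proof (intro sum_mono)
    fix x
    have "(d2 - d1) $ x * b $ x \<le> \<bar>(d2 - d1) $ x\<bar> * \<bar>b $ x\<bar>"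
      by (metis abs_ge_self abs_mult)
    also have "\<dots> \<le> \<bar>(d2 - d1) $ x\<bar> * ?eps"
      by (intro mult_left_mono b_le) simp
    finally show "(d2 - d1) $ x \<bullet> b $ x \<le> \<bar>(d2 - d1) $ x\<bar> * ?eps"
      by simp
  qed
  also have "\<dots> = norm1 (d2 - d1) * ?eps"
    by (simp add: norm1_def sum_distrib_right)
  also have "\<dots> \<le> \<gamma> * (?tau * (2 * ?TV)) * ?eps"
    by (intro mult_right_mono d_le eps)
  finally have "d2 \<bullet> b \<le> d1 \<bullet> b + 2 * \<gamma> * ?eps * ?tau * ?TV"
    by (simp add: inner_diff_left mult_ac)
  \<comment> \<open>\<open>d2 \<bullet> b\<close> is the difference of returns, and
    \<open>d1 \<bullet> b\<close> is the expected advantage in the claim.\<close>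
  then show ?thesis
    unfolding performance_difference[OF \<gamma>] by (simp add: d1_def d2_def b_def inner_vec_def)
qed

end
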